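(* Let $(T,\mu,\eta,c,u)$ be a colax gs-monoidal monad on a poset-enriched gs-monoidal category $\mathcal{C}$. If $\mathcal{C}$ is a cartesian bicategory, then so is the Kleisli category $\mathcal{C}_T$.
   Context: Coherence isomorphisms of monoidal structures are suppressed; $\gamma$ denotes the braiding. A gs-monoidal category is a symmetric monoidal category $(\mathcal{C},\otimes,I)$ together with, for every object $X$, arrows $\nabla_X\colon X\to X\otimes X$ and $!_X\colon X\to I$ making $X$ a commutative comonoid, with $\nabla_{X\otimes Y}=(\mathrm{id}_X\otimes\gamma_{X,Y}\otimes\mathrm{id}_Y)\circ(\nabla_X\otimes\nabla_Y)$, $\nabla_I=\mathrm{id}_I$, $!_{X\otimes Y}=\,!_X\otimes !_Y$, $!_I=\mathrm{id}_I$ (no naturality required). It is poset-enriched if its hom-sets are partially ordered so that composition and $\otimes$ are monotone. A posetal oplax cartesian category is a poset-enriched gs-monoidal category such that $\nabla_Y\circ f\le(f\otimes f)\circ\nabla_X$ and $!_Y\circ f\le\,!_X$ for every arrow $f\colon X\to Y$. A cartesian bicategory is a posetal oplax cartesian category such that for every object $X$ the arrows $\nabla_X$ and $!_X$ have right adjoints, i.e. there are arrows $\Delta_X\colon X\otimes X\to X$ and $\text{¡}_X\colon I\to X$ with $\mathrm{id}_X\le\Delta_X\circ\nabla_X$, $\nabla_X\circ\Delta_X\le\mathrm{id}_{X\otimes X}$, $\mathrm{id}_X\le\text{¡}_X\circ !_X$, $!_X\circ\text{¡}_X\le\mathrm{id}_I$. A symmetric monoidal monad $(T,\mu,\eta,c,u)$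 is a monad $(T,\mu,\eta)$ together with a lax symmetric monoidal structure on $T$ given by $c_{X,Y}\colon TX\otimes TY\to T(X\otimes Y)$ (natural) and $u\colon I\to TI$, such that $u=\eta_I$, $c_{X,Y}\circ(\eta_X\otimes\eta_Y)=\eta_{X\otimes Y}$, and $\mu_{X\otimes Y}\circ T(c_{X,Y})\circ c_{TX,TY}=c_{X,Y}\circ(\mu_X\otimes\mu_Y)$. It is a colax gs-monoidal monad if $T$ is an enriched functor (monotone on hom-posets) and for all $X$: $T(!_X)\le u\circ !_{TX}$ and $T(\nabla_X)\le c_{X,X}\circ\nabla_{TX}$. The Kleisli category $\mathcal{C}_T$ is regarded as a poset-enriched gs-monoidal category with: hom-posets $\mathcal{C}_T(X,Y)=\mathcal{C}(X,TY)$; $X\otimes^\sharp Y:=X\otimes Y$ on objects; $f\otimes^\sharp g:=c_{X',Y'}\circ(f\otimes g)$ for $f\colon X\to TX'$, $g\colon Y\to TY'$; unit $I$; structural isomorphisms those of $\mathcal{C}$ postcomposed with $\eta$; $\nabla^\sharp_X:=\eta_{X\otimes X}\circ\nabla_X$ and $!^\sharp_X:=\eta_I\circ !_X$. *)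

theory Defs
  imports Main
begin

text \<open>
  Every arrow has a unique domain and codomain, so hom-sets are disjoint. The monoidal structure
  is not assumed strict: associators and unitors are written out wherever the usual presentation
  suppresses them.
\<close>

record ('o, 'a) cat =
  Obj :: "'o set"
  Arr :: "'a set"
  Dom :: "'a \<Rightarrow> 'o"
  Cod :: "'a \<Rightarrow> 'o"
  Ident :: "'o \<Rightarrow> 'a"  ("\<one>\<index>")
  Comp :: "'a \<Rightarrow> 'a \<Rightarrow> 'a"  (infixr "\<cdot>\<index>" 55)

definition hom :: "('o, 'a, 'm) cat_scheme \<Rightarrow> 'o \<Rightarrow> 'o \<Rightarrow> 'a set" where
  "hom C X Y = {f \<in> Arr C. Dom C f = X \<and> Cod C f = Y}"

definition inverse_arrows :: "('o, 'a, 'm) cat_scheme \<Rightarrow> 'a \<Rightarrow> 'a \<Rightarrow> bool" where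
  "inverse_arrows C f g \<longleftrightarrow>
     f \<in> Arr C \<and> g \<in> hom C (Cod C f) (Dom C f) \<and>
     g \<cdot>\<^bsub>C\<^esub> f = \<one>\<^bsub>C\<^esub> (Dom C f) \<and> f \<cdot>\<^bsub>C\<^esub> g = \<one>\<^bsub>C\<^esub> (Cod C f)"

definition is_iso :: "('o, 'a, 'm) cat_scheme \<Rightarrow> 'a \<Rightarrow> bool" where
  "is_iso C f \<longleftrightarrow> (\<exists>g. inverse_arrows C f g)"

definition inverse_of :: "('o, 'a, 'm) cat_scheme \<Rightarrow> 'a \<Rightarrow> 'a" where
  "inverse_of C f = (THE g. inverse_arrows C f g)"

locale category =
  fixes C :: "('o, 'a, 'm) cat_scheme" (structure)
  assumes Dom_Obj: "f \<in> Arr C \<Longrightarrow> Dom C f \<in> Obj C"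
    and Cod_Obj: "f \<in> Arr C \<Longrightarrow> Cod C f \<in> Obj C"
    and Ident_hom: "X \<in> Obj C \<Longrightarrow> \<one> X \<in> hom C X X"
    and Comp_hom: "\<lbrakk>f \<in> hom C X Y; g \<in> hom C Y Z\<rbrakk> \<Longrightarrow> g \<cdot> f \<in> hom C X Z"
    and Comp_Ident: "f \<in> hom C X Y \<Longrightarrow> f \<cdot> \<one> X = f"
    and Ident_Comp: "f \<in> hom C X Y \<Longrightarrow> \<one> Y \<cdot> f = f"
    and Comp_assoc:
      "\<lbrakk>f \<in> hom C W X; g \<in> hom C X Y; h \<in> hom C Y Z\<rbrakk> \<Longrightarrow> (h \<cdot> g) \<cdot> f = h \<cdot> (g \<cdot> f)"

record ('o, 'a) smc_data = "('o, 'a) cat" +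
  TensO :: "'o \<Rightarrow> 'o \<Rightarrow> 'o"  (infixr "\<odot>\<index>" 70)
  Tens :: "'a \<Rightarrow> 'a \<Rightarrow> 'a"  (infixr "\<otimes>\<index>" 70)
  Unit :: 'o  ("\<I>\<index>")
  assoc :: "'o \<Rightarrow> 'o \<Rightarrow> 'o \<Rightarrow> 'a"  ("\<alpha>\<index>")
  lunit :: "'o \<Rightarrow> 'a"  ("\<l>\<index>")
  runit :: "'o \<Rightarrow> 'a"  ("\<r>\<index>")
  braid :: "'o \<Rightarrow> 'o \<Rightarrow> 'a"  ("\<gamma>\<index>")

locale symmetric_monoidal_category = category C
  for C :: "('o, 'a, 'm) smc_data_scheme" (structure) +
  assumes TensO_Obj: "\<lbrakk>X \<in> Obj C; Y \<in> Obj C\<rbrakk> \<Longrightarrow> X \<odot> Y \<in> Obj C"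
    and Unit_Obj: "\<I> \<in> Obj C"
    and Tens_hom:
      "\<lbrakk>f \<in> hom C X X'; g \<in> hom C Y Y'\<rbrakk> \<Longrightarrow> f \<otimes> g \<in> hom C (X \<odot> Y) (X' \<odot> Y')"
    and Tens_Ident: "\<lbrakk>X \<in> Obj C; Y \<in> Obj C\<rbrakk> \<Longrightarrow> \<one> X \<otimes> \<one> Y = \<one> (X \<odot> Y)"
    and Tens_Comp:
      "\<lbrakk>f \<in> hom C X X'; f' \<in> hom C X' X''; g \<in> hom C Y Y'; g' \<in> hom C Y' Y''\<rbrakk>
        \<Longrightarrow> (f' \<cdot> f) \<otimes> (g' \<cdot> g) = (f' \<otimes> g') \<cdot> (f \<otimes> g)"
    and assoc_hom:
      "\<lbrakk>X \<in> Obj C; Y \<in> Obj C; Z \<in> Obj C\<rbrakk>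
        \<Longrightarrow> \<alpha> X Y Z \<in> hom C ((X \<odot> Y) \<odot> Z) (X \<odot> (Y \<odot> Z))"
    and assoc_iso: "\<lbrakk>X \<in> Obj C; Y \<in> Obj C; Z \<in> Obj C\<rbrakk> \<Longrightarrow> is_iso C (\<alpha> X Y Z)"
    and assoc_nat:
      "\<lbrakk>f \<in> hom C X X'; g \<in> hom C Y Y'; h \<in> hom C Z Z'\<rbrakk>
        \<Longrightarrow> \<alpha> X' Y' Z' \<cdot> ((f \<otimes> g) \<otimes> h) = (f \<otimes> (g \<otimes> h)) \<cdot> \<alpha> X Y Z"
    and lunit_hom: "X \<in> Obj C \<Longrightarrow> \<l> X \<in> hom C (\<I> \<odot> X) X"
    and lunit_iso: "X \<in> Obj C \<Longrightarrow> is_iso C (\<l> X)"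
    and lunit_nat: "f \<in> hom C X Y \<Longrightarrow> \<l> Y \<cdot> (\<one> \<I> \<otimes> f) = f \<cdot> \<l> X"
    and runit_hom: "X \<in> Obj C \<Longrightarrow> \<r> X \<in> hom C (X \<odot> \<I>) X"
    and runit_iso: "X \<in> Obj C \<Longrightarrow> is_iso C (\<r> X)"
    and runit_nat: "f \<in> hom C X Y \<Longrightarrow> \<r> Y \<cdot> (f \<otimes> \<one> \<I>) = f \<cdot> \<r> X"
    and pentagon:
      "\<lbrakk>W \<in> Obj C; X \<in> Obj C; Y \<in> Obj C; Z \<in> Obj C\<rbrakk>
        \<Longrightarrow> \<alpha> W X (Y \<odot> Z) \<cdot> \<alpha> (W \<odot> X) Y Z
          = (\<one> W \<otimes> \<alpha> X Y Z) \<cdot> \<alpha> W (X \<odot> Y) Z \<cdot> (\<alpha> W X Y \<otimes> \<one> Z)"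
    and triangle:
      "\<lbrakk>X \<in> Obj C; Y \<in> Obj C\<rbrakk> \<Longrightarrow> (\<one> X \<otimes> \<l> Y) \<cdot> \<alpha> X \<I> Y = \<r> X \<otimes> \<one> Y"
    and braid_hom: "\<lbrakk>X \<in> Obj C; Y \<in> Obj C\<rbrakk> \<Longrightarrow> \<gamma> X Y \<in> hom C (X \<odot> Y) (Y \<odot> X)"
    and braid_nat:
      "\<lbrakk>f \<in> hom C X X'; g \<in> hom C Y Y'\<rbrakk> \<Longrightarrow> \<gamma> X' Y' \<cdot> (f \<otimes> g) = (g \<otimes> f) \<cdot> \<gamma> X Y"
    and braid_symmetric: "\<lbrakk>X \<in> Obj C; Y \<in> Obj C\<rbrakk> \<Longrightarrow> \<gamma> Y X \<cdot> \<gamma> X Y = \<one> (X \<odot> Y)"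
    and hexagon:
      "\<lbrakk>X \<in> Obj C; Y \<in> Obj C; Z \<in> Obj C\<rbrakk>
        \<Longrightarrow> \<alpha> Y Z X \<cdot> \<gamma> X (Y \<odot> Z) \<cdot> \<alpha> X Y Z
          = (\<one> Y \<otimes> \<gamma> X Z) \<cdot> \<alpha> Y X Z \<cdot> (\<gamma> X Y \<otimes> \<one> Z)"

text \<open>
  The arrow \<open>(W \<odot> X) \<odot> (Y \<odot> Z) \<rightarrow> (W \<odot> Y) \<odot> (X \<odot> Z)\<close> usually written \<open>id \<otimes> \<gamma> \<otimes> id\<close>.
\<close>

definition mid_swap :: "('o, 'a, 'm) smc_data_scheme \<Rightarrow> 'o \<Rightarrow> 'o \<Rightarrow> 'o \<Rightarrow> 'o \<Rightarrow> 'a" where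
  "mid_swap C W X Y Z =
     inverse_of C (\<alpha>\<^bsub>C\<^esub> W Y (X \<odot>\<^bsub>C\<^esub> Z)) \<cdot>\<^bsub>C\<^esub>
     (\<one>\<^bsub>C\<^esub> W \<otimes>\<^bsub>C\<^esub>
        (\<alpha>\<^bsub>C\<^esub> Y X Z \<cdot>\<^bsub>C\<^esub> (\<gamma>\<^bsub>C\<^esub> X Y \<otimes>\<^bsub>C\<^esub> \<one>\<^bsub>C\<^esub> Z) \<cdot>\<^bsub>C\<^esub> inverse_of C (\<alpha>\<^bsub>C\<^esub> X Y Z))) \<cdot>\<^bsub>C\<^esub>
     \<alpha>\<^bsub>C\<^esub> W X (Y \<odot>\<^bsub>C\<^esub> Z)"

record ('o, 'a) gs_data = "('o, 'a) smc_data" +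
  copy :: "'o \<Rightarrow> 'a"  ("\<nabla>\<index>")
  discard :: "'o \<Rightarrow> 'a"  ("\<epsilon>\<index>")

locale gs_monoidal_category = symmetric_monoidal_category C
  for C :: "('o, 'a, 'm) gs_data_scheme" (structure) +
  assumes copy_hom: "X \<in> Obj C \<Longrightarrow> \<nabla> X \<in> hom C X (X \<odot> X)"
    and discard_hom: "X \<in> Obj C \<Longrightarrow> \<epsilon> X \<in> hom C X \<I>"
    and copy_coassoc:
      "X \<in> Obj C \<Longrightarrow> \<alpha> X X X \<cdot> (\<nabla> X \<otimes> \<one> X) \<cdot> \<nabla> X = (\<one> X \<otimes> \<nabla> X) \<cdot> \<nabla> X"
    and copy_lcounit: "X \<in> Obj C \<Longrightarrow> \<l> X \<cdot> (\<epsilon> X \<otimes> \<one> X) \<cdot> \<nabla> X = \<one> X"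
    and copy_rcounit: "X \<in> Obj C \<Longrightarrow> \<r> X \<cdot> (\<one> X \<otimes> \<epsilon> X) \<cdot> \<nabla> X = \<one> X"
    and copy_cocomm: "X \<in> Obj C \<Longrightarrow> \<gamma> X X \<cdot> \<nabla> X = \<nabla> X"
    and copy_TensO:
      "\<lbrakk>X \<in> Obj C; Y \<in> Obj C\<rbrakk> \<Longrightarrow> \<nabla> (X \<odot> Y) = mid_swap C X X Y Y \<cdot> (\<nabla> X \<otimes> \<nabla> Y)"
    and copy_Unit: "\<nabla> \<I> = inverse_of C (\<l> \<I>)"
    and discard_TensO:
      "\<lbrakk>X \<in> Obj C; Y \<in> Obj C\<rbrakk> \<Longrightarrow> \<epsilon> (X \<odot> Y) = \<l> \<I> \<cdot> (\<epsilon> X \<otimes> \<epsilon> Y)"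
    and discard_Unit: "\<epsilon> \<I> = \<one> \<I>"

text \<open>The order is only meaningful between parallel arrows.\<close>

record ('o, 'a) pgs_data = "('o, 'a) gs_data" +
  Le :: "'a \<Rightarrow> 'a \<Rightarrow> bool"  (infix "\<sqsubseteq>\<index>" 50)

locale poset_enriched_gs_monoidal_category = gs_monoidal_category C
  for C :: "('o, 'a, 'm) pgs_data_scheme" (structure) +
  assumes Le_refl: "f \<in> hom C X Y \<Longrightarrow> f \<sqsubseteq> f"
    and Le_trans:
      "\<lbrakk>f \<in> hom C X Y; g \<in> hom C X Y; h \<in> hom C X Y; f \<sqsubseteq> g; g \<sqsubseteq> h\<rbrakk> \<Longrightarrow> f \<sqsubseteq> h"
    and Le_antisym: "\<lbrakk>f \<in> hom C X Y; g \<in> hom C X Y; f \<sqsubseteq> g; g \<sqsubseteq> f\<rbrakk> \<Longrightarrow> f = g"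
    and Comp_mono:
      "\<lbrakk>f \<in> hom C X Y; f' \<in> hom C X Y; g \<in> hom C Y Z; g' \<in> hom C Y Z; f \<sqsubseteq> f'; g \<sqsubseteq> g'\<rbrakk>
        \<Longrightarrow> g \<cdot> f \<sqsubseteq> g' \<cdot> f'"
    and Tens_mono:
      "\<lbrakk>f \<in> hom C X X'; f' \<in> hom C X X'; g \<in> hom C Y Y'; g' \<in> hom C Y Y'; f \<sqsubseteq> f'; g \<sqsubseteq> g'\<rbrakk>
        \<Longrightarrow> f \<otimes> g \<sqsubseteq> f' \<otimes> g'"

locale posetal_oplax_cartesian_category = poset_enriched_gs_monoidal_category C
  for C :: "('o, 'a, 'm) pgs_data_scheme" (structure) +
  assumes copy_oplax: "f \<in> hom C X Y \<Longrightarrow> \<nabla> Y \<cdot> f \<sqsubseteq> (f \<otimes> f) \<cdot> \<nabla> X"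
    and discard_oplax: "f \<in> hom C X Y \<Longrightarrow> \<epsilon> Y \<cdot> f \<sqsubseteq> \<epsilon> X"

definition right_adjoint :: "('o, 'a, 'm) pgs_data_scheme \<Rightarrow> 'a \<Rightarrow> 'a \<Rightarrow> bool" where
  "right_adjoint C f g \<longleftrightarrow>
     f \<in> Arr C \<and> g \<in> hom C (Cod C f) (Dom C f) \<and>
     \<one>\<^bsub>C\<^esub> (Dom C f) \<sqsubseteq>\<^bsub>C\<^esub> g \<cdot>\<^bsub>C\<^esub> f \<and> f \<cdot>\<^bsub>C\<^esub> g \<sqsubseteq>\<^bsub>C\<^esub> \<one>\<^bsub>C\<^esub> (Cod C f)"

locale cartesian_bicategory = posetal_oplax_cartesian_category C
  for C :: "('o, 'a, 'm) pgs_data_scheme" (structure) +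
  assumes copy_right_adjoint: "X \<in> Obj C \<Longrightarrow> \<exists>d. right_adjoint C (\<nabla> X) d"
    and discard_right_adjoint: "X \<in> Obj C \<Longrightarrow> \<exists>e. right_adjoint C (\<epsilon> X) e"

text \<open>\<open>T\<^sub>O\<close> and \<open>T\<close> are the object and arrow parts of the functor.\<close>

locale cat_monad = category C
  for C :: "('o, 'a, 'm) cat_scheme" (structure) +
  fixes T\<^sub>O :: "'o \<Rightarrow> 'o" and T :: "'a \<Rightarrow> 'a" and \<mu> :: "'o \<Rightarrow> 'a" and \<eta> :: "'o \<Rightarrow> 'a"
  assumes T_Obj: "X \<in> Obj C \<Longrightarrow> T\<^sub>O X \<in> Obj C"
    and T_hom: "f \<in> hom C X Y \<Longrightarrow> T f \<in> hom C (T\<^sub>O X) (T\<^sub>O Y)"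
    and T_Ident: "X \<in> Obj C \<Longrightarrow> T (\<one> X) = \<one> (T\<^sub>O X)"
    and T_Comp: "\<lbrakk>f \<in> hom C X Y; g \<in> hom C Y Z\<rbrakk> \<Longrightarrow> T (g \<cdot> f) = T g \<cdot> T f"
    and mult_hom: "X \<in> Obj C \<Longrightarrow> \<mu> X \<in> hom C (T\<^sub>O (T\<^sub>O X)) (T\<^sub>O X)"
    and mult_nat: "f \<in> hom C X Y \<Longrightarrow> \<mu> Y \<cdot> T (T f) = T f \<cdot> \<mu> X"
    and unit_hom: "X \<in> Obj C \<Longrightarrow> \<eta> X \<in> hom C X (T\<^sub>O X)"
    and unit_nat: "f \<in> hom C X Y \<Longrightarrow> \<eta> Y \<cdot> f = T f \<cdot> \<eta> X"
    and mult_assoc: "X \<in> Obj C \<Longrightarrow> \<mu> X \<cdot> T (\<mu> X) = \<mu> X \<cdot> \<mu> (T\<^sub>O X)"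
    and mult_T_unit: "X \<in> Obj C \<Longrightarrow> \<mu> X \<cdot> T (\<eta> X) = \<one> (T\<^sub>O X)"
    and mult_unit_T: "X \<in> Obj C \<Longrightarrow> \<mu> X \<cdot> \<eta> (T\<^sub>O X) = \<one> (T\<^sub>O X)"

locale symmetric_monoidal_monad =
  symmetric_monoidal_category C + cat_monad C T\<^sub>O T \<mu> \<eta>
  for C :: "('o, 'a, 'm) smc_data_scheme" (structure) and T\<^sub>O T \<mu> \<eta> +
  fixes c :: "'o \<Rightarrow> 'o \<Rightarrow> 'a" and u :: 'a
  assumes lax_hom:
      "\<lbrakk>X \<in> Obj C; Y \<in> Obj C\<rbrakk> \<Longrightarrow> c X Y \<in> hom C (T\<^sub>O X \<odot> T\<^sub>O Y) (T\<^sub>O (X \<odot> Y))"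
    and lax_nat:
      "\<lbrakk>f \<in> hom C X X'; g \<in> hom C Y Y'\<rbrakk> \<Longrightarrow> c X' Y' \<cdot> (T f \<otimes> T g) = T (f \<otimes> g) \<cdot> c X Y"
    and lax_unit_hom: "u \<in> hom C \<I> (T\<^sub>O \<I>)"
    and lax_assoc:
      "\<lbrakk>X \<in> Obj C; Y \<in> Obj C; Z \<in> Obj C\<rbrakk>
        \<Longrightarrow> T (\<alpha> X Y Z) \<cdot> c (X \<odot> Y) Z \<cdot> (c X Y \<otimes> \<one> (T\<^sub>O Z))
          = c X (Y \<odot> Z) \<cdot> (\<one> (T\<^sub>O X) \<otimes> c Y Z) \<cdot> \<alpha> (T\<^sub>O X) (T\<^sub>O Y) (T\<^sub>O Z)"
    and lax_lunit: "X \<in> Obj C \<Longrightarrow> T (\<l> X) \<cdot> c \<I> X \<cdot> (u \<otimes> \<one> (T\<^sub>O X)) = \<l> (T\<^sub>O X)"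
    and lax_runit: "X \<in> Obj C \<Longrightarrow> T (\<r> X) \<cdot> c X \<I> \<cdot> (\<one> (T\<^sub>O X) \<otimes> u) = \<r> (T\<^sub>O X)"
    and lax_braid:
      "\<lbrakk>X \<in> Obj C; Y \<in> Obj C\<rbrakk> \<Longrightarrow> T (\<gamma> X Y) \<cdot> c X Y = c Y X \<cdot> \<gamma> (T\<^sub>O X) (T\<^sub>O Y)"
    and lax_unit_eq: "u = \<eta> \<I>"
    and lax_unit_monoidal:
      "\<lbrakk>X \<in> Obj C; Y \<in> Obj C\<rbrakk> \<Longrightarrow> c X Y \<cdot> (\<eta> X \<otimes> \<eta> Y) = \<eta> (X \<odot> Y)"
    and lax_mult_monoidal:
      "\<lbrakk>X \<in> Obj C; Y \<in> Obj C\<rbrakk>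
        \<Longrightarrow> \<mu> (X \<odot> Y) \<cdot> T (c X Y) \<cdot> c (T\<^sub>O X) (T\<^sub>O Y) = c X Y \<cdot> (\<mu> X \<otimes> \<mu> Y)"

locale colax_gs_monoidal_monad =
  poset_enriched_gs_monoidal_category C + symmetric_monoidal_monad C T\<^sub>O T \<mu> \<eta> c u
  for C :: "('o, 'a, 'm) pgs_data_scheme" (structure) and T\<^sub>O T \<mu> \<eta> c u +
  assumes T_mono: "\<lbrakk>f \<in> hom C X Y; g \<in> hom C X Y; f \<sqsubseteq> g\<rbrakk> \<Longrightarrow> T f \<sqsubseteq> T g"
    and discard_colax: "X \<in> Obj C \<Longrightarrow> T (\<epsilon> X) \<sqsubseteq> u \<cdot> \<epsilon> (T\<^sub>O X)"
    and copy_colax: "X \<in> Obj C \<Longrightarrow> T (\<nabla> X) \<sqsubseteq> c X X \<cdot> \<nabla> (T\<^sub>O X)"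

text \<open>
  A Kleisli arrow \<open>X \<rightarrow> Y\<close> is a pair \<open>(Y, f)\<close> with \<open>f : X \<rightarrow> T\<^sub>O Y\<close>. The codomain has to be
  recorded because \<open>T\<^sub>O\<close> need not be injective; thus the hom-poset from \<open>X\<close> to \<open>Y\<close> is a copy of
  \<open>hom C X (T\<^sub>O Y)\<close>.
\<close>

definition kleisli_lift :: "('o, 'a, 'm) cat_scheme \<Rightarrow> ('o \<Rightarrow> 'a) \<Rightarrow> 'a \<Rightarrow> 'o \<times> 'a" where
  "kleisli_lift C \<eta> f = (Cod C f, \<eta> (Cod C f) \<cdot>\<^bsub>C\<^esub> f)"

definition kleisli ::
  "('o, 'a, 'm) pgs_data_scheme \<Rightarrow> ('o \<Rightarrow> 'o) \<Rightarrow> ('a \<Rightarrow> 'a) \<Rightarrow> ('o \<Rightarrow> 'a) \<Rightarrow> ('o \<Rightarrow> 'a)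
    \<Rightarrow> ('o \<Rightarrow> 'o \<Rightarrow> 'a) \<Rightarrow> ('o, 'o \<times> 'a) pgs_data" where
  "kleisli C T\<^sub>O T \<mu> \<eta> c =
     \<lparr>Obj = Obj C,
      Arr = {(Y, f). Y \<in> Obj C \<and> f \<in> Arr C \<and> Cod C f = T\<^sub>O Y},
      Dom = (\<lambda>(Y, f). Dom C f),
      Cod = (\<lambda>(Y, f). Y),
      Ident = (\<lambda>X. (X, \<eta> X)),
      Comp = (\<lambda>(Z, g) (Y, f). (Z, \<mu> Z \<cdot>\<^bsub>C\<^esub> T g \<cdot>\<^bsub>C\<^esub> f)),
      TensO = TensO C,
      Tens = (\<lambda>(X', f) (Y', g). (X' \<odot>\<^bsub>C\<^esub> Y', c X' Y' \<cdot>\<^bsub>C\<^esub> (f \<otimes>\<^bsub>C\<^esub> g))),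
      Unit = Unit C,
      assoc = (\<lambda>X Y Z. kleisli_lift C \<eta> (\<alpha>\<^bsub>C\<^esub> X Y Z)),
      lunit = (\<lambda>X. kleisli_lift C \<eta> (\<l>\<^bsub>C\<^esub> X)),
      runit = (\<lambda>X. kleisli_lift C \<eta> (\<r>\<^bsub>C\<^esub> X)),
      braid = (\<lambda>X Y. kleisli_lift C \<eta> (\<gamma>\<^bsub>C\<^esub> X Y)),
      copy = (\<lambda>X. kleisli_lift C \<eta> (\<nabla>\<^bsub>C\<^esub> X)),
      discard = (\<lambda>X. kleisli_lift C \<eta> (\<epsilon>\<^bsub>C\<^esub> X)),
      Le = (\<lambda>(Y, f) (Y', g). Y = Y' \<and> f \<sqsubseteq>\<^bsub>C\<^esub> g)\<rparr>"

end

theory Submission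
  imports Defs
begin

text \<open>
  Postcomposition with the unit turns an arrow \<open>f : X \<rightarrow> Y\<close> of \<open>C\<close> into a Kleisli arrow
  \<open>L f = (Y, \<eta> Y \<cdot> f)\<close>, and all structural arrows of the Kleisli category \<open>K\<close> are of this form. The proof
  rests on \<open>L\<close> being a strict symmetric monoidal functor that is monotone on hom-posets
  (\<open>lift_Comp\<close>, \<open>lift_Tens\<close>, \<open>lift_mono\<close>). Whatever such a functor preserves can be transported from
  \<open>C\<close> to \<open>K\<close>: inverses, equations between structural arrows (the coherence laws and the comonoid
  laws), and adjunctions. In particular the right adjoints of \<open>\<nabla>\<close> and \<open>\<epsilon>\<close> in \<open>K\<close> are the lifts of
  those in \<open>C\<close>.

  The laws that quantify over arbitrary arrows of \<open>K\<close> do not follow by transport. Composing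
  \<open>f : X \<rightarrow> T\<^sub>O Y\<close> with a lifted arrow on either side involves no multiplication:
  \<open>L b \<circ> f = T b \<cdot> f\<close> and \<open>f \<circ> L a = f \<cdot> a\<close> (\<open>lift_Comp_kleisli\<close>, \<open>kleisli_Comp_lift\<close>). Naturality of
  the structural isomorphisms thus becomes their naturality in \<open>C\<close> together with the laws of the lax
  symmetric monoidal functor \<open>T\<close>, and the oplax conditions become
  \<open>T (\<nabla> Y) \<cdot> f \<sqsubseteq> c Y Y \<cdot> \<nabla> (T\<^sub>O Y) \<cdot> f \<sqsubseteq> c Y Y \<cdot> (f \<otimes> f) \<cdot> \<nabla> X\<close> and
  \<open>T (\<epsilon> Y) \<cdot> f \<sqsubseteq> u \<cdot> \<epsilon> (T\<^sub>O Y) \<cdot> f \<sqsubseteq> u \<cdot> \<epsilon> X\<close>, where the first inequality of each chain is colaxity of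
  \<open>T\<close> and the second is the oplax condition of \<open>C\<close>. The interchange law rests on the compatibility
  of \<open>\<mu>\<close> with \<open>c\<close>, and monotonicity of Kleisli composition on that of \<open>T\<close>.
\<close>

section \<open>Typing, inverses and monad laws\<close>

text \<open>Composability is phrased below through \<open>Dom\<close> and \<open>Cod\<close> instead of hom-sets: the side
  conditions then contain no intermediate objects to be guessed, and simplification discharges them
  by computing domains and codomains.\<close>

context category
begin

lemma hom_ObjD:
  assumes "f \<in> hom C X Y"
  shows "f \<in> Arr C" "Dom C f = X" "Cod C f = Y" "X \<in> Obj C" "Y \<in> Obj C"
  using assms Dom_Obj Cod_Obj by (auto simp: hom_def)

lemma Ident_typing [simp]:
  assumes "X \<in> Obj C"
  shows "\<one> X \<in> Arr C" "Dom C (\<one> X) = X" "Cod C (\<one> X) = X"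
  using Ident_hom[OF assms] by (auto simp: hom_def)

lemma Comp_typing [simp]:
  assumes "f \<in> Arr C" "g \<in> Arr C" "Cod C f = Dom C g"
  shows "g \<cdot> f \<in> Arr C" "Dom C (g \<cdot> f) = Dom C f" "Cod C (g \<cdot> f) = Cod C g"
  using Comp_hom[of f "Dom C f" "Dom C g" g "Cod C g"] assms by (auto simp: hom_def)

lemma Comp_assoc_Arr:
  assumes "f \<in> Arr C" "g \<in> Arr C" "h \<in> Arr C" "Cod C f = Dom C g" "Cod C g = Dom C h"
  shows "(h \<cdot> g) \<cdot> f = h \<cdot> g \<cdot> f"
  using Comp_assoc[of f "Dom C f" "Dom C g" g "Dom C h" h "Cod C h"] assms by (auto simp: hom_def)

lemma Comp_Ident_Arr [simp]: "\<lbrakk>f \<in> Arr C; Dom C f = X\<rbrakk> \<Longrightarrow> f \<cdot> \<one> X = f"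
  using Comp_Ident by (auto simp: hom_def)

lemma Ident_Comp_Arr [simp]: "\<lbrakk>f \<in> Arr C; Cod C f = Y\<rbrakk> \<Longrightarrow> \<one> Y \<cdot> f = f"
  using Ident_Comp by (auto simp: hom_def)

lemma inverse_arrows_unique:
  assumes "inverse_arrows C f g" "inverse_arrows C f h"
  shows "g = h"
proof -
  have "g = g \<cdot> (f \<cdot> h)"
    using assms by (auto simp: inverse_arrows_def hom_def)
  also have "\<dots> = (g \<cdot> f) \<cdot> h"
    using assms by (intro Comp_assoc_Arr[symmetric]) (auto simp: inverse_arrows_def hom_def)
  also have "\<dots> = h"
    using assms by (auto simp: inverse_arrows_def hom_def)
  finally show ?thesis .
qed

lemma inverse_of_eqI: "inverse_arrows C f g \<Longrightarrow> inverse_of C f = g"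
  unfolding inverse_of_def using inverse_arrows_unique by blast

lemma inverse_arrows_inverse_of: "is_iso C f \<Longrightarrow> inverse_arrows C f (inverse_of C f)"
  using inverse_of_eqI by (auto simp: is_iso_def)

lemma inverse_of_typing [simp]:
  assumes "is_iso C f"
  shows "inverse_of C f \<in> Arr C" "Dom C (inverse_of C f) = Cod C f"
    "Cod C (inverse_of C f) = Dom C f"
  using inverse_arrows_inverse_of[OF assms] by (auto simp: inverse_arrows_def hom_def)

end

context symmetric_monoidal_category
begin

lemma Tens_typing [simp]:
  assumes "f \<in> Arr C" "g \<in> Arr C"
  shows "f \<otimes> g \<in> Arr C" "Dom C (f \<otimes> g) = Dom C f \<odot> Dom C g" "Cod C (f \<otimes> g) = Cod C f \<odot> Cod C g"
  using Tens_hom[of f "Dom C f" "Cod C f" g "Dom C g" "Cod C g"] assms by (auto simp: hom_def)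

lemma Tens_Comp_Arr:
  assumes "f \<in> Arr C" "f' \<in> Arr C" "Cod C f = Dom C f'"
    and "g \<in> Arr C" "g' \<in> Arr C" "Cod C g = Dom C g'"
  shows "(f' \<cdot> f) \<otimes> (g' \<cdot> g) = (f' \<otimes> g') \<cdot> (f \<otimes> g)"
  using assms by (intro Tens_Comp) (auto simp: hom_def)

lemma assoc_typing [simp]:
  assumes "X \<in> Obj C" "Y \<in> Obj C" "Z \<in> Obj C"
  shows "\<alpha> X Y Z \<in> Arr C" "Dom C (\<alpha> X Y Z) = (X \<odot> Y) \<odot> Z" "Cod C (\<alpha> X Y Z) = X \<odot> (Y \<odot> Z)"
  using assoc_hom assms by (auto simp: hom_def)

lemma unitor_typing [simp]:
  assumes "X \<in> Obj C"
  shows "\<l> X \<in> Arr C" "Dom C (\<l> X) = \<I> \<odot> X" "Cod C (\<l> X) = X"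
    and "\<r> X \<in> Arr C" "Dom C (\<r> X) = X \<odot> \<I>" "Cod C (\<r> X) = X"
  using lunit_hom runit_hom assms by (auto simp: hom_def)

lemma braid_typing [simp]:
  assumes "X \<in> Obj C" "Y \<in> Obj C"
  shows "\<gamma> X Y \<in> Arr C" "Dom C (\<gamma> X Y) = X \<odot> Y" "Cod C (\<gamma> X Y) = Y \<odot> X"
  using braid_hom assms by (auto simp: hom_def)

declare TensO_Obj [simp] Unit_Obj [simp] Tens_Ident [simp]
  assoc_iso [simp] lunit_iso [simp] runit_iso [simp]

end

context cat_monad
begin

declare T_Obj [simp] T_Ident [simp]

lemma T_typing [simp]:
  assumes "f \<in> Arr C"
  shows "T f \<in> Arr C" "Dom C (T f) = T\<^sub>O (Dom C f)" "Cod C (T f) = T\<^sub>O (Cod C f)"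
  using T_hom[of f "Dom C f" "Cod C f"] assms by (auto simp: hom_def)

lemma T_Comp_Arr:
  "\<lbrakk>f \<in> Arr C; g \<in> Arr C; Cod C f = Dom C g\<rbrakk> \<Longrightarrow> T (g \<cdot> f) = T g \<cdot> T f"
  using T_Comp[of f "Dom C f" "Dom C g" g "Cod C g"] by (auto simp: hom_def)

lemma monad_typing [simp]:
  assumes "X \<in> Obj C"
  shows "\<mu> X \<in> Arr C" "Dom C (\<mu> X) = T\<^sub>O (T\<^sub>O X)" "Cod C (\<mu> X) = T\<^sub>O X"
    and "\<eta> X \<in> Arr C" "Dom C (\<eta> X) = X" "Cod C (\<eta> X) = T\<^sub>O X"
  using mult_hom unit_hom assms by (auto simp: hom_def)

text \<open>An arrow that is postcomposed with the unit can enter a Kleisli composite on the left or on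
  the right. On the left the unit is absorbed by \<open>\<mu> \<cdot> T \<eta> = id\<close>; on the right, naturality first
  moves it next to \<open>\<mu>\<close>, where \<open>\<mu> \<cdot> \<eta> = id\<close> absorbs it.\<close>

lemma mult_T_lift:
  assumes b: "b \<in> hom C Y Z" and f: "f \<in> hom C X (T\<^sub>O Y)"
  shows "\<mu> Z \<cdot> T (\<eta> Z \<cdot> b) \<cdot> f = T b \<cdot> f"
proof -
  note [simp] = hom_ObjD[OF b] hom_ObjD[OF f]
  have "\<mu> Z \<cdot> T (\<eta> Z \<cdot> b) \<cdot> f = (\<mu> Z \<cdot> T (\<eta> Z)) \<cdot> T b \<cdot> f"
    by (simp add: T_Comp_Arr Comp_assoc_Arr)
  then show ?thesis by (simp add: mult_T_unit)
qed

lemma mult_T_unit_Comp: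
  assumes a: "a \<in> hom C X Y" and g: "g \<in> hom C Y (T\<^sub>O Z)" and Z: "Z \<in> Obj C"
  shows "\<mu> Z \<cdot> T g \<cdot> \<eta> Y \<cdot> a = g \<cdot> a"
proof -
  note [simp] = hom_ObjD[OF a] hom_ObjD[OF g] Z
  have "\<mu> Z \<cdot> T g \<cdot> \<eta> Y \<cdot> a = \<mu> Z \<cdot> (T g \<cdot> \<eta> Y) \<cdot> a"
    by (simp add: Comp_assoc_Arr)
  also have "\<dots> = (\<mu> Z \<cdot> \<eta> (T\<^sub>O Z)) \<cdot> g \<cdot> a"
    by (simp add: unit_nat[OF g, symmetric] Comp_assoc_Arr)
  finally show ?thesis by (simp add: mult_unit_T)
qed

end

section \<open>Kleisli arrows and lifted arrows\<close>

context poset_enriched_gs_monoidal_category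
begin

lemma Comp_mono_left:
  assumes "g \<in> hom C Y Z" "g' \<in> hom C Y Z" "g \<sqsubseteq> g'" "f \<in> hom C X Y"
  shows "g \<cdot> f \<sqsubseteq> g' \<cdot> f"
  using assms Comp_mono Le_refl by blast

lemma Comp_mono_right:
  assumes "f \<in> hom C X Y" "f' \<in> hom C X Y" "f \<sqsubseteq> f'" "g \<in> hom C Y Z"
  shows "g \<cdot> f \<sqsubseteq> g \<cdot> f'"
  using assms Comp_mono Le_refl by blast

end

context colax_gs_monoidal_monad
begin

abbreviation K where "K \<equiv> kleisli C T\<^sub>O T \<mu> \<eta> c"
abbreviation L where "L \<equiv> kleisli_lift C \<eta>"

lemma lax_typing [simp]:
  assumes "X \<in> Obj C" "Y \<in> Obj C"
  shows "c X Y \<in> Arr C" "Dom C (c X Y) = T\<^sub>O X \<odot> T\<^sub>O Y" "Cod C (c X Y) = T\<^sub>O (X \<odot> Y)"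
  using lax_hom assms by (auto simp: hom_def)

lemma gs_typing [simp]:
  assumes "X \<in> Obj C"
  shows "\<nabla> X \<in> Arr C" "Dom C (\<nabla> X) = X" "Cod C (\<nabla> X) = X \<odot> X"
    and "\<epsilon> X \<in> Arr C" "Dom C (\<epsilon> X) = X" "Cod C (\<epsilon> X) = \<I>"
  using copy_hom discard_hom assms by (auto simp: hom_def)

lemma kleisli_sel [simp]:
  "Obj K = Obj C" "Ident K X = (X, \<eta> X)" "TensO K = TensO C" "Unit K = \<I>"
  "assoc K X Y Z = L (\<alpha> X Y Z)" "lunit K X = L (\<l> X)" "runit K X = L (\<r> X)"
  "braid K X Y = L (\<gamma> X Y)" "copy K X = L (\<nabla> X)" "discard K X = L (\<epsilon> X)"
  "Dom K (Y, f) = Dom C f" "Cod K (Y, f) = Y"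
  "Tens K (Y, f) (Z, g) = (Y \<odot> Z, c Y Z \<cdot> (f \<otimes> g))"
  "Le K (Y, f) (Z, g) \<longleftrightarrow> Y = Z \<and> f \<sqsubseteq> g"
  "(Y, f) \<in> Arr K \<longleftrightarrow> Y \<in> Obj C \<and> f \<in> Arr C \<and> Cod C f = T\<^sub>O Y"
  by (simp_all add: kleisli_def)

lemma kleisli_Comp: "(Z, g) \<cdot>\<^bsub>K\<^esub> (Y, f) = (Z, \<mu> Z \<cdot> T g \<cdot> f)"
  by (simp add: kleisli_def)

lemma kleisli_hom_iff:
  "p \<in> hom K X Y \<longleftrightarrow> (\<exists>f. p = (Y, f) \<and> Y \<in> Obj C \<and> f \<in> hom C X (T\<^sub>O Y))"
  by (cases p) (auto simp: hom_def)

lemma kleisli_homE: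
  assumes "p \<in> hom K X Y"
  obtains f where "p = (Y, f)" "f \<in> hom C X (T\<^sub>O Y)" "f \<in> Arr C" "Dom C f = X" "Cod C f = T\<^sub>O Y"
    "X \<in> Obj C" "Y \<in> Obj C"
  using assms hom_ObjD by (auto simp: kleisli_hom_iff)

lemma lift_typing [simp]:
  assumes "f \<in> Arr C"
  shows "L f \<in> Arr K" "Dom K (L f) = Dom C f" "Cod K (L f) = Cod C f"
  using assms Dom_Obj Cod_Obj by (auto simp: kleisli_lift_def)

lemma lift_hom: "f \<in> hom C X Y \<Longrightarrow> L f \<in> hom K X Y"
  by (simp add: hom_def)

text \<open>Through these two rules every comparison between a structural arrow of \<open>K\<close> and an arbitrary
  Kleisli arrow becomes an equation or inequality in \<open>C\<close> without \<open>\<mu>\<close>.\<close>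

lemma lift_Comp_kleisli:
  assumes "b \<in> hom C Y Z" "f \<in> hom C X (T\<^sub>O Y)"
  shows "L b \<cdot>\<^bsub>K\<^esub> (Y, f) = (Z, T b \<cdot> f)"
  using assms hom_ObjD(3)[OF assms(1)] by (simp add: kleisli_lift_def kleisli_Comp mult_T_lift)

lemma kleisli_Comp_lift:
  assumes "a \<in> hom C X Y" "g \<in> hom C Y (T\<^sub>O Z)" "Z \<in> Obj C"
  shows "(Z, g) \<cdot>\<^bsub>K\<^esub> L a = (Z, g \<cdot> a)"
  using assms hom_ObjD(3)[OF assms(1)] by (simp add: kleisli_lift_def kleisli_Comp mult_T_unit_Comp)

text \<open>Oriented to fold, because the structural arrows of \<open>K\<close> should all appear as lifts; composites
  and tensors of lifts then collapse to one lift of an arrow of \<open>C\<close>.\<close>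

lemma lift_Ident: "X \<in> Obj C \<Longrightarrow> (X, \<eta> X) = L (\<one> X)"
  by (simp add: kleisli_lift_def)

lemma lift_Comp:
  assumes "f \<in> Arr C" "g \<in> Arr C" "Cod C f = Dom C g"
  shows "L g \<cdot>\<^bsub>K\<^esub> L f = L (g \<cdot> f)"
proof -
  have "L g \<cdot>\<^bsub>K\<^esub> L f = (Cod C g, (\<eta> (Cod C g) \<cdot> g) \<cdot> f)"
    unfolding kleisli_lift_def[of C \<eta> g]
    using assms Dom_Obj Cod_Obj by (intro kleisli_Comp_lift) (auto simp: hom_def)
  with assms show ?thesis
    by (simp add: kleisli_lift_def Comp_assoc_Arr Cod_Obj)
qed

text \<open>The underlying law is the compatibility of \<open>c\<close> with the unit, \<open>c \<cdot> (\<eta> \<otimes> \<eta>) = \<eta>\<close>.\<close>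

lemma lift_Tens:
  assumes "f \<in> Arr C" "g \<in> Arr C"
  shows "L f \<otimes>\<^bsub>K\<^esub> L g = L (f \<otimes> g)"
proof -
  let ?Y = "Cod C f" and ?Z = "Cod C g"
  note [simp] = assms Dom_Obj[OF assms(1)] Cod_Obj[OF assms(1)] Dom_Obj[OF assms(2)] Cod_Obj[OF assms(2)]
  have "c ?Y ?Z \<cdot> ((\<eta> ?Y \<cdot> f) \<otimes> (\<eta> ?Z \<cdot> g)) = (c ?Y ?Z \<cdot> (\<eta> ?Y \<otimes> \<eta> ?Z)) \<cdot> (f \<otimes> g)"
    by (simp add: Tens_Comp_Arr Comp_assoc_Arr)
  then show ?thesis by (simp add: kleisli_lift_def lax_unit_monoidal)
qed

lemma lift_mono:
  assumes "f \<in> hom C X Y" "g \<in> hom C X Y" "f \<sqsubseteq> g"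
  shows "L f \<sqsubseteq>\<^bsub>K\<^esub> L g"
  using hom_ObjD[OF assms(1)] hom_ObjD[OF assms(2)] Comp_mono_right[OF assms unit_hom]
  by (simp add: kleisli_lift_def)

section \<open>The Kleisli category as a symmetric monoidal category\<close>

lemma kleisli_category: "category K"
proof
  show "Dom K p \<in> Obj K" if "p \<in> Arr K" for p
    using that Dom_Obj by (cases p) simp
  show "Cod K p \<in> Obj K" if "p \<in> Arr K" for p
    using that by (cases p) simp
  show "Ident K X \<in> hom K X X" if "X \<in> Obj K" for X
    using that by (simp add: hom_def)
  show "q \<cdot>\<^bsub>K\<^esub> p \<in> hom K X Z" if "p \<in> hom K X Y" "q \<in> hom K Y Z" for p q X Y Z
    using that by (elim kleisli_homE) (auto simp: hom_def kleisli_Comp)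
  show "p \<cdot>\<^bsub>K\<^esub> Ident K X = p" if "p \<in> hom K X Y" for p X Y
    using that
  proof (rule kleisli_homE)
    fix f assume p: "p = (Y, f)" and f: "f \<in> hom C X (T\<^sub>O Y)" "X \<in> Obj C" "Y \<in> Obj C"
    then show ?thesis
      using kleisli_Comp_lift[OF Ident_hom f(1)] by (simp add: lift_Ident Comp_Ident)
  qed
  show "Ident K Y \<cdot>\<^bsub>K\<^esub> p = p" if "p \<in> hom K X Y" for p X Y
    using that
  proof (rule kleisli_homE)
    fix f assume p: "p = (Y, f)" and f: "f \<in> hom C X (T\<^sub>O Y)" "X \<in> Obj C" "Y \<in> Obj C"
    then show ?thesis
      using lift_Comp_kleisli[OF Ident_hom f(1)]
      by (simp add: lift_Ident Ident_Comp)
  qed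
  show "(r \<cdot>\<^bsub>K\<^esub> q) \<cdot>\<^bsub>K\<^esub> p = r \<cdot>\<^bsub>K\<^esub> q \<cdot>\<^bsub>K\<^esub> p"
    if "p \<in> hom K W X" "q \<in> hom K X Y" "r \<in> hom K Y Z" for p q r W X Y Z
    using that
  proof (elim kleisli_homE)
    fix f g h
    assume [simp]: "p = (X, f)" "q = (Y, g)" "r = (Z, h)"
      "f \<in> Arr C" "Dom C f = W" "Cod C f = T\<^sub>O X" "g \<in> Arr C" "Dom C g = X" "Cod C g = T\<^sub>O Y"
      "h \<in> Arr C" "Dom C h = Y" "Cod C h = T\<^sub>O Z"
      "X \<in> Obj C" "Y \<in> Obj C" "Z \<in> Obj C" and h: "h \<in> hom C Y (T\<^sub>O Z)"
    have "\<mu> Z \<cdot> T (\<mu> Z \<cdot> T h \<cdot> g) \<cdot> f = (\<mu> Z \<cdot> T (\<mu> Z)) \<cdot> T (T h) \<cdot> T g \<cdot> f"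
      by (simp add: T_Comp_Arr Comp_assoc_Arr)
    also have "\<dots> = \<mu> Z \<cdot> (\<mu> (T\<^sub>O Z) \<cdot> T (T h)) \<cdot> T g \<cdot> f"
      by (simp add: mult_assoc Comp_assoc_Arr)
    also have "\<dots> = \<mu> Z \<cdot> T h \<cdot> \<mu> Y \<cdot> T g \<cdot> f"
      by (simp add: mult_nat[OF h] Comp_assoc_Arr)
    finally show ?thesis by (simp add: kleisli_Comp)
  qed
qed

text \<open>A functor preserves inverses, so the inverses that occur in the coherence axioms of \<open>K\<close> are
  lifts as well.\<close>

lemma lift_inverse_arrows:
  assumes "inverse_arrows C f g"
  shows "inverse_arrows K (L f) (L g)"
  using assms Dom_Obj Cod_Obj by (auto simp: inverse_arrows_def hom_def lift_Comp lift_Ident)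

lemma lift_iso: "is_iso C f \<Longrightarrow> is_iso K (L f)"
  unfolding is_iso_def using lift_inverse_arrows by blast

lemma lift_inverse_of: "is_iso C f \<Longrightarrow> inverse_of K (L f) = L (inverse_of C f)"
  by (rule category.inverse_of_eqI[OF kleisli_category])
    (rule lift_inverse_arrows[OF inverse_arrows_inverse_of])

lemma lift_mid_swap:
  assumes "W \<in> Obj C" "X \<in> Obj C" "Y \<in> Obj C" "Z \<in> Obj C"
  shows "mid_swap K W X Y Z = L (mid_swap C W X Y Z)"
  using assms by (simp add: mid_swap_def lift_Ident lift_inverse_of lift_Comp lift_Tens)

lemma mid_swap_typing [simp]:
  assumes "W \<in> Obj C" "X \<in> Obj C" "Y \<in> Obj C" "Z \<in> Obj C"
  shows "mid_swap C W X Y Z \<in> Arr C" "Dom C (mid_swap C W X Y Z) = (W \<odot> X) \<odot> (Y \<odot> Z)"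
    "Cod C (mid_swap C W X Y Z) = (W \<odot> Y) \<odot> (X \<odot> Z)"
  using assms by (simp_all add: mid_swap_def)

text \<open>The interchange law is the compatibility of \<open>c\<close> with the multiplication,
  \<open>\<mu> \<cdot> T c \<cdot> c = c \<cdot> (\<mu> \<otimes> \<mu>)\<close>, together with the naturality of \<open>c\<close>.\<close>

lemma kleisli_Tens_Comp:
  assumes "p \<in> hom K X X'" "p' \<in> hom K X' X''" "q \<in> hom K Y Y'" "q' \<in> hom K Y' Y''"
  shows "(p' \<cdot>\<^bsub>K\<^esub> p) \<otimes>\<^bsub>K\<^esub> (q' \<cdot>\<^bsub>K\<^esub> q) = (p' \<otimes>\<^bsub>K\<^esub> q') \<cdot>\<^bsub>K\<^esub> (p \<otimes>\<^bsub>K\<^esub> q)"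
  using assms
proof (elim kleisli_homE)
  fix f f' g g'
  assume [simp]: "p = (X', f)" "p' = (X'', f')" "q = (Y', g)" "q' = (Y'', g')"
    "f \<in> Arr C" "Dom C f = X" "Cod C f = T\<^sub>O X'" "f' \<in> Arr C" "Dom C f' = X'" "Cod C f' = T\<^sub>O X''"
    "g \<in> Arr C" "Dom C g = Y" "Cod C g = T\<^sub>O Y'" "g' \<in> Arr C" "Dom C g' = Y'" "Cod C g' = T\<^sub>O Y''"
    "X' \<in> Obj C" "X'' \<in> Obj C" "Y' \<in> Obj C" "Y'' \<in> Obj C"
    and f': "f' \<in> hom C X' (T\<^sub>O X'')" and g': "g' \<in> hom C Y' (T\<^sub>O Y'')"
  have "c X'' Y'' \<cdot> ((\<mu> X'' \<cdot> T f' \<cdot> f) \<otimes> (\<mu> Y'' \<cdot> T g' \<cdot> g))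
      = (c X'' Y'' \<cdot> (\<mu> X'' \<otimes> \<mu> Y'')) \<cdot> (T f' \<otimes> T g') \<cdot> (f \<otimes> g)"
    by (simp add: Tens_Comp_Arr Comp_assoc_Arr)
  also have "\<dots> = \<mu> (X'' \<odot> Y'') \<cdot> T (c X'' Y'') \<cdot> (c (T\<^sub>O X'') (T\<^sub>O Y'') \<cdot> (T f' \<otimes> T g')) \<cdot> (f \<otimes> g)"
    by (simp add: lax_mult_monoidal[symmetric] Comp_assoc_Arr)
  also have "\<dots> = \<mu> (X'' \<odot> Y'') \<cdot> T (c X'' Y'' \<cdot> (f' \<otimes> g')) \<cdot> c X' Y' \<cdot> (f \<otimes> g)"
    by (simp add: lax_nat[OF f' g'] T_Comp_Arr Comp_assoc_Arr)
  finally show ?thesis by (simp add: kleisli_Comp)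
qed

text \<open>Naturality against arbitrary Kleisli arrows does not follow by lifting: each of the four
  squares is the naturality square in \<open>C\<close> pasted to the axiom by which \<open>c\<close> and \<open>u\<close> make \<open>T\<close> a lax
  symmetric monoidal functor.\<close>

lemma kleisli_assoc_nat:
  assumes "p \<in> hom K X X'" "q \<in> hom K Y Y'" "r \<in> hom K Z Z'"
  shows "L (\<alpha> X' Y' Z') \<cdot>\<^bsub>K\<^esub> ((p \<otimes>\<^bsub>K\<^esub> q) \<otimes>\<^bsub>K\<^esub> r) = (p \<otimes>\<^bsub>K\<^esub> (q \<otimes>\<^bsub>K\<^esub> r)) \<cdot>\<^bsub>K\<^esub> L (\<alpha> X Y Z)"
  using assms
proof (elim kleisli_homE)
  fix f g h
  assume [simp]: "p = (X', f)" "q = (Y', g)" "r = (Z', h)"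
    "f \<in> Arr C" "Dom C f = X" "Cod C f = T\<^sub>O X'" "g \<in> Arr C" "Dom C g = Y" "Cod C g = T\<^sub>O Y'"
    "h \<in> Arr C" "Dom C h = Z" "Cod C h = T\<^sub>O Z'"
    "X \<in> Obj C" "X' \<in> Obj C" "Y \<in> Obj C" "Y' \<in> Obj C" "Z \<in> Obj C" "Z' \<in> Obj C"
    and f: "f \<in> hom C X (T\<^sub>O X')" and g: "g \<in> hom C Y (T\<^sub>O Y')" and h: "h \<in> hom C Z (T\<^sub>O Z')"
  have 1: "(c X' Y' \<cdot> (f \<otimes> g)) \<otimes> h = (c X' Y' \<otimes> \<one> (T\<^sub>O Z')) \<cdot> ((f \<otimes> g) \<otimes> h)"
    using Tens_Comp_Arr[of "f \<otimes> g" "c X' Y'" h "\<one> (T\<^sub>O Z')"] by simp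
  have 2: "f \<otimes> (c Y' Z' \<cdot> (g \<otimes> h)) = (\<one> (T\<^sub>O X') \<otimes> c Y' Z') \<cdot> (f \<otimes> (g \<otimes> h))"
    using Tens_Comp_Arr[of f "\<one> (T\<^sub>O X')" "g \<otimes> h" "c Y' Z'"] by simp
  have "T (\<alpha> X' Y' Z') \<cdot> c (X' \<odot> Y') Z' \<cdot> ((c X' Y' \<cdot> (f \<otimes> g)) \<otimes> h)
      = (T (\<alpha> X' Y' Z') \<cdot> c (X' \<odot> Y') Z' \<cdot> (c X' Y' \<otimes> \<one> (T\<^sub>O Z'))) \<cdot> ((f \<otimes> g) \<otimes> h)"
    by (simp add: 1 Comp_assoc_Arr)
  also have "\<dots> = c X' (Y' \<odot> Z') \<cdot> (\<one> (T\<^sub>O X') \<otimes> c Y' Z') \<cdot>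
      (\<alpha> (T\<^sub>O X') (T\<^sub>O Y') (T\<^sub>O Z') \<cdot> ((f \<otimes> g) \<otimes> h))"
    by (simp add: lax_assoc Comp_assoc_Arr)
  also have "\<dots> = (c X' (Y' \<odot> Z') \<cdot> (f \<otimes> (c Y' Z' \<cdot> (g \<otimes> h)))) \<cdot> \<alpha> X Y Z"
    by (simp add: assoc_nat[OF f g h] 2 Comp_assoc_Arr)
  finally show ?thesis
    by (simp add: lift_Comp_kleisli kleisli_Comp_lift hom_def)
qed

lemma kleisli_lunit_nat:
  assumes "p \<in> hom K X Y"
  shows "L (\<l> Y) \<cdot>\<^bsub>K\<^esub> ((\<I>, \<eta> \<I>) \<otimes>\<^bsub>K\<^esub> p) = p \<cdot>\<^bsub>K\<^esub> L (\<l> X)"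
  using assms
proof (rule kleisli_homE)
  fix f
  assume [simp]: "p = (Y, f)" "f \<in> Arr C" "Dom C f = X" "Cod C f = T\<^sub>O Y" "X \<in> Obj C" "Y \<in> Obj C"
    and f: "f \<in> hom C X (T\<^sub>O Y)"
  have 1: "\<eta> \<I> \<otimes> f = (\<eta> \<I> \<otimes> \<one> (T\<^sub>O Y)) \<cdot> (\<one> \<I> \<otimes> f)"
    using Tens_Comp_Arr[of "\<one> \<I>" "\<eta> \<I>" f "\<one> (T\<^sub>O Y)"] by simp
  have "T (\<l> Y) \<cdot> c \<I> Y \<cdot> (\<eta> \<I> \<otimes> f)
      = (T (\<l> Y) \<cdot> c \<I> Y \<cdot> (\<eta> \<I> \<otimes> \<one> (T\<^sub>O Y))) \<cdot> (\<one> \<I> \<otimes> f)"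
    by (simp add: 1 Comp_assoc_Arr)
  also have "\<dots> = f \<cdot> \<l> X"
    using lax_lunit[of Y] lunit_nat[OF f] by (simp add: lax_unit_eq)
  finally show ?thesis
    by (simp add: lift_Comp_kleisli kleisli_Comp_lift hom_def)
qed

lemma kleisli_runit_nat:
  assumes "p \<in> hom K X Y"
  shows "L (\<r> Y) \<cdot>\<^bsub>K\<^esub> (p \<otimes>\<^bsub>K\<^esub> (\<I>, \<eta> \<I>)) = p \<cdot>\<^bsub>K\<^esub> L (\<r> X)"
  using assms
proof (rule kleisli_homE)
  fix f
  assume [simp]: "p = (Y, f)" "f \<in> Arr C" "Dom C f = X" "Cod C f = T\<^sub>O Y" "X \<in> Obj C" "Y \<in> Obj C"
    and f: "f \<in> hom C X (T\<^sub>O Y)"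
  have 1: "f \<otimes> \<eta> \<I> = (\<one> (T\<^sub>O Y) \<otimes> \<eta> \<I>) \<cdot> (f \<otimes> \<one> \<I>)"
    using Tens_Comp_Arr[of f "\<one> (T\<^sub>O Y)" "\<one> \<I>" "\<eta> \<I>"] by simp
  have "T (\<r> Y) \<cdot> c Y \<I> \<cdot> (f \<otimes> \<eta> \<I>)
      = (T (\<r> Y) \<cdot> c Y \<I> \<cdot> (\<one> (T\<^sub>O Y) \<otimes> \<eta> \<I>)) \<cdot> (f \<otimes> \<one> \<I>)"
    by (simp add: 1 Comp_assoc_Arr)
  also have "\<dots> = f \<cdot> \<r> X"
    using lax_runit[of Y] runit_nat[OF f] by (simp add: lax_unit_eq)
  finally show ?thesis
    by (simp add: lift_Comp_kleisli kleisli_Comp_lift hom_def)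
qed

lemma kleisli_braid_nat:
  assumes "p \<in> hom K X X'" "q \<in> hom K Y Y'"
  shows "L (\<gamma> X' Y') \<cdot>\<^bsub>K\<^esub> (p \<otimes>\<^bsub>K\<^esub> q) = (q \<otimes>\<^bsub>K\<^esub> p) \<cdot>\<^bsub>K\<^esub> L (\<gamma> X Y)"
  using assms
proof (elim kleisli_homE)
  fix f g
  assume [simp]: "p = (X', f)" "q = (Y', g)"
    "f \<in> Arr C" "Dom C f = X" "Cod C f = T\<^sub>O X'" "g \<in> Arr C" "Dom C g = Y" "Cod C g = T\<^sub>O Y'"
    "X \<in> Obj C" "X' \<in> Obj C" "Y \<in> Obj C" "Y' \<in> Obj C"
    and f: "f \<in> hom C X (T\<^sub>O X')" and g: "g \<in> hom C Y (T\<^sub>O Y')"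
  have "T (\<gamma> X' Y') \<cdot> c X' Y' \<cdot> (f \<otimes> g) = (T (\<gamma> X' Y') \<cdot> c X' Y') \<cdot> (f \<otimes> g)"
    by (simp add: Comp_assoc_Arr)
  also have "\<dots> = c Y' X' \<cdot> (\<gamma> (T\<^sub>O X') (T\<^sub>O Y') \<cdot> (f \<otimes> g))"
    by (simp add: lax_braid Comp_assoc_Arr)
  also have "\<dots> = (c Y' X' \<cdot> (g \<otimes> f)) \<cdot> \<gamma> X Y"
    by (simp add: braid_nat[OF f g] Comp_assoc_Arr)
  finally show ?thesis
    by (simp add: lift_Comp_kleisli kleisli_Comp_lift hom_def)
qed

lemma kleisli_symmetric_monoidal: "symmetric_monoidal_category K"
proof (intro symmetric_monoidal_category.intro kleisli_category symmetric_monoidal_category_axioms.intro)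
  show "p \<otimes>\<^bsub>K\<^esub> q \<in> hom K (X \<odot>\<^bsub>K\<^esub> Y) (X' \<odot>\<^bsub>K\<^esub> Y')" if "p \<in> hom K X X'" "q \<in> hom K Y Y'" for p q X X' Y Y'
    using that by (elim kleisli_homE) (simp add: hom_def)
qed (simp_all add: kleisli_Tens_Comp kleisli_assoc_nat
    kleisli_lunit_nat[unfolded lift_Ident[OF Unit_Obj]] kleisli_runit_nat[unfolded lift_Ident[OF Unit_Obj]]
    kleisli_braid_nat lift_hom lift_iso assoc_hom lunit_hom runit_hom braid_hom
    lift_Ident lift_Comp lift_Tens pentagon triangle braid_symmetric hexagon)

section \<open>Copying, discarding and their adjoints\<close>

lemma kleisli_gs_monoidal: "gs_monoidal_category K"
  by (intro gs_monoidal_category.intro kleisli_symmetric_monoidal gs_monoidal_category_axioms.intro)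
    (simp_all add: lift_hom copy_hom discard_hom lift_Ident lift_Comp lift_Tens lift_mid_swap
      lift_inverse_of copy_coassoc copy_lcounit copy_rcounit copy_cocomm copy_TensO copy_Unit
      discard_TensO discard_Unit)

lemma kleisli_poset_enriched: "poset_enriched_gs_monoidal_category K"
proof (intro poset_enriched_gs_monoidal_category.intro kleisli_gs_monoidal
    poset_enriched_gs_monoidal_category_axioms.intro)
  show "p \<sqsubseteq>\<^bsub>K\<^esub> p" if "p \<in> hom K X Y" for p X Y
    using that Le_refl by (auto elim!: kleisli_homE)
  show "p \<sqsubseteq>\<^bsub>K\<^esub> r" if "p \<in> hom K X Y" "q \<in> hom K X Y" "r \<in> hom K X Y" "p \<sqsubseteq>\<^bsub>K\<^esub> q" "q \<sqsubseteq>\<^bsub>K\<^esub> r" for p q r X Y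
    using that by (elim kleisli_homE) (clarsimp, rule Le_trans)
  show "p = q" if "p \<in> hom K X Y" "q \<in> hom K X Y" "p \<sqsubseteq>\<^bsub>K\<^esub> q" "q \<sqsubseteq>\<^bsub>K\<^esub> p" for p q X Y
    using that by (elim kleisli_homE) (clarsimp, rule Le_antisym)
  show "q \<cdot>\<^bsub>K\<^esub> p \<sqsubseteq>\<^bsub>K\<^esub> q' \<cdot>\<^bsub>K\<^esub> p'"
    if "p \<in> hom K X Y" "p' \<in> hom K X Y" "q \<in> hom K Y Z" "q' \<in> hom K Y Z" "p \<sqsubseteq>\<^bsub>K\<^esub> p'" "q \<sqsubseteq>\<^bsub>K\<^esub> q'"
    for p p' q q' X Y Z
    using that
  proof (elim kleisli_homE)
    fix f f' g g'
    assume p: "p = (Y, f)" "p' = (Y, f')" "q = (Z, g)" "q' = (Z, g')"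
      and f: "f \<in> hom C X (T\<^sub>O Y)" "f' \<in> hom C X (T\<^sub>O Y)"
      and g: "g \<in> hom C Y (T\<^sub>O Z)" "g' \<in> hom C Y (T\<^sub>O Z)" and Z: "Z \<in> Obj C"
    have le: "f \<sqsubseteq> f'" "g \<sqsubseteq> g'" using that p by simp_all
    have "T g \<cdot> f \<sqsubseteq> T g' \<cdot> f'"
      by (rule Comp_mono[OF f T_hom T_hom le(1) T_mono]) fact+
    then have "\<mu> Z \<cdot> T g \<cdot> f \<sqsubseteq> \<mu> Z \<cdot> T g' \<cdot> f'"
      by (rule Comp_mono_right[OF Comp_hom Comp_hom _ mult_hom, rotated 4]) (use f g Z T_hom in auto)
    with p show ?thesis by (simp add: kleisli_Comp)
  qed
  show "p \<otimes>\<^bsub>K\<^esub> q \<sqsubseteq>\<^bsub>K\<^esub> p' \<otimes>\<^bsub>K\<^esub> q'"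
    if "p \<in> hom K X X'" "p' \<in> hom K X X'" "q \<in> hom K Y Y'" "q' \<in> hom K Y Y'" "p \<sqsubseteq>\<^bsub>K\<^esub> p'" "q \<sqsubseteq>\<^bsub>K\<^esub> q'"
    for p p' q q' X X' Y Y'
    using that
  proof (elim kleisli_homE)
    fix f f' g g'
    assume p: "p = (X', f)" "p' = (X', f')" "q = (Y', g)" "q' = (Y', g')"
      and f: "f \<in> hom C X (T\<^sub>O X')" "f' \<in> hom C X (T\<^sub>O X')"
      and g: "g \<in> hom C Y (T\<^sub>O Y')" "g' \<in> hom C Y (T\<^sub>O Y')" and o: "X' \<in> Obj C" "Y' \<in> Obj C"
    have le: "f \<sqsubseteq> f'" "g \<sqsubseteq> g'" using that p by simp_all
    have "c X' Y' \<cdot> (f \<otimes> g) \<sqsubseteq> c X' Y' \<cdot> (f' \<otimes> g')"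
      by (rule Comp_mono_right[OF Tens_hom Tens_hom Tens_mono lax_hom]) fact+
    with p show ?thesis by simp
  qed
qed

text \<open>The colax conditions compare \<open>T \<nabla>\<close> and \<open>T \<epsilon>\<close> with the copying and discarding of the object
  \<open>T\<^sub>O Y\<close>; the arrow \<open>X \<rightarrow> T\<^sub>O Y\<close> that underlies a Kleisli arrow can then be passed through these by
  the oplax conditions in \<open>C\<close>.\<close>

lemma kleisli_posetal_oplax_cartesian:
  assumes "posetal_oplax_cartesian_category C"
  shows "posetal_oplax_cartesian_category K"
proof (intro posetal_oplax_cartesian_category.intro kleisli_poset_enriched
    posetal_oplax_cartesian_category_axioms.intro)
  interpret C: posetal_oplax_cartesian_category C by fact
  show "\<nabla>\<^bsub>K\<^esub> Y \<cdot>\<^bsub>K\<^esub> p \<sqsubseteq>\<^bsub>K\<^esub> (p \<otimes>\<^bsub>K\<^esub> p) \<cdot>\<^bsub>K\<^esub> \<nabla>\<^bsub>K\<^esub> X" if "p \<in> hom K X Y" for p X Y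
    using that
  proof (rule kleisli_homE)
    fix f
    assume [simp]: "p = (Y, f)" "f \<in> Arr C" "Dom C f = X" "Cod C f = T\<^sub>O Y" "X \<in> Obj C" "Y \<in> Obj C"
      and f: "f \<in> hom C X (T\<^sub>O Y)"
    have "T (\<nabla> Y) \<cdot> f \<sqsubseteq> (c Y Y \<cdot> \<nabla> (T\<^sub>O Y)) \<cdot> f"
      by (rule Comp_mono_left[OF _ _ copy_colax f]) (simp_all add: hom_def)
    moreover have "(c Y Y \<cdot> \<nabla> (T\<^sub>O Y)) \<cdot> f \<sqsubseteq> c Y Y \<cdot> (f \<otimes> f) \<cdot> \<nabla> X"
      using Comp_mono_right[OF _ _ C.copy_oplax[OF f] lax_hom[of Y Y]]
      by (simp add: hom_def Comp_assoc_Arr)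
    ultimately have "T (\<nabla> Y) \<cdot> f \<sqsubseteq> c Y Y \<cdot> (f \<otimes> f) \<cdot> \<nabla> X"
      by (rule Le_trans[rotated 3]) (simp_all add: hom_def)
    then show ?thesis
      by (simp add: lift_Comp_kleisli kleisli_Comp_lift hom_def Comp_assoc_Arr)
  qed
  show "\<epsilon>\<^bsub>K\<^esub> Y \<cdot>\<^bsub>K\<^esub> p \<sqsubseteq>\<^bsub>K\<^esub> \<epsilon>\<^bsub>K\<^esub> X" if "p \<in> hom K X Y" for p X Y
    using that
  proof (rule kleisli_homE)
    fix f
    assume [simp]: "p = (Y, f)" "f \<in> Arr C" "Dom C f = X" "Cod C f = T\<^sub>O Y" "X \<in> Obj C" "Y \<in> Obj C"
      and f: "f \<in> hom C X (T\<^sub>O Y)"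
    have "T (\<epsilon> Y) \<cdot> f \<sqsubseteq> (\<eta> \<I> \<cdot> \<epsilon> (T\<^sub>O Y)) \<cdot> f"
      by (rule Comp_mono_left[OF _ _ discard_colax[unfolded lax_unit_eq] f]) (simp_all add: hom_def)
    moreover have "(\<eta> \<I> \<cdot> \<epsilon> (T\<^sub>O Y)) \<cdot> f \<sqsubseteq> \<eta> \<I> \<cdot> \<epsilon> X"
      using Comp_mono_right[OF _ _ C.discard_oplax[OF f] unit_hom[of \<I>]]
      by (simp add: hom_def Comp_assoc_Arr)
    ultimately have "T (\<epsilon> Y) \<cdot> f \<sqsubseteq> \<eta> \<I> \<cdot> \<epsilon> X"
      by (rule Le_trans[rotated 3]) (simp_all add: hom_def)
    then show ?thesis
      by (simp add: lift_Comp_kleisli[OF discard_hom f] kleisli_lift_def[of C \<eta> "\<epsilon> X"])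
  qed
qed

text \<open>A locally monotone functor preserves adjunctions, since it preserves both of the inequalities
  that define them.\<close>

lemma lift_right_adjoint:
  assumes "right_adjoint C f g"
  shows "right_adjoint K (L f) (L g)"
proof -
  have f: "f \<in> Arr C" "Dom C f \<in> Obj C" "Cod C f \<in> Obj C"
    and g: "g \<in> Arr C" "Dom C g = Cod C f" "Cod C g = Dom C f"
    using assms Dom_Obj Cod_Obj by (auto simp: right_adjoint_def hom_def)
  have "L (\<one> (Dom C f)) \<sqsubseteq>\<^bsub>K\<^esub> L (g \<cdot> f)"
    by (rule lift_mono) (use assms f g in \<open>auto simp: right_adjoint_def hom_def\<close>)
  moreover have "L (f \<cdot> g) \<sqsubseteq>\<^bsub>K\<^esub> L (\<one> (Cod C f))"
    by (rule lift_mono) (use assms f g in \<open>auto simp: right_adjoint_def hom_def\<close>)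
  ultimately show ?thesis
    using f g by (simp add: right_adjoint_def hom_def lift_Comp lift_Ident)
qed

end

theorem proposition4p35:
  fixes C :: "('o, 'a, 'm) pgs_data_scheme"
    and T\<^sub>O :: "'o \<Rightarrow> 'o" and T :: "'a \<Rightarrow> 'a" and \<mu> \<eta> :: "'o \<Rightarrow> 'a"
    and c :: "'o \<Rightarrow> 'o \<Rightarrow> 'a" and u :: 'a
  assumes "colax_gs_monoidal_monad C T\<^sub>O T \<mu> \<eta> c u"
    and "cartesian_bicategory C"
  shows "cartesian_bicategory (kleisli C T\<^sub>O T \<mu> \<eta> c)"
proof -
  interpret colax_gs_monoidal_monad C T\<^sub>O T \<mu> \<eta> c u by fact
  interpret C: cartesian_bicategory C by fact
  show ?thesis
  proof (intro cartesian_bicategory.intro cartesian_bicategory_axioms.intro)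
    show "posetal_oplax_cartesian_category K"
      by (rule kleisli_posetal_oplax_cartesian) (rule C.posetal_oplax_cartesian_category_axioms)
    show "\<exists>d. right_adjoint K (copy K X) d" if "X \<in> Obj K" for X
      using that C.copy_right_adjoint lift_right_adjoint by fastforce
    show "\<exists>e. right_adjoint K (discard K X) e" if "X \<in> Obj K" for X
      using that C.discard_right_adjoint lift_right_adjoint by fastforce
  qed
qed

end
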